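(* Let $p\in(1,+\infty)$ and let $\Lambda=(\lambda_n)_{n\in\mathbb N}$ be an increasing sequence of non-negative real numbers with $\sum_{n\ge1}\frac1{\lambda_n}<+\infty$ and $\inf_n(\lambda_{n+1}-\lambda_n)>0$. The following are equivalent: (i) the sequence $\Lambda$ is quasi-lacunary; (ii) the operator $J_\Lambda:b\mapsto\sum_nb_nt^{\lambda_n}$ is bounded on $\ell^p(\omega)$ (that is, bounded from $\ell^p(\omega)$ to $M_\Lambda^p$), where $\omega_n=(p\lambda_n+1)^{-1}$.
   Context: $L^p=L^p([0,1],m)$ with $m$ the Lebesgue measure. $M_\Lambda^p$ is the closed linear span of the monomials $t^{\lambda_n}$, $n\in\mathbb N$, in $L^p$. $\ell^p(\omega)$ is the Banach space of complex sequences $b=(b_n)_n$ with norm $(\sum_n|b_n|^p\omega_n)^{1/p}$, where $\omega_n=(p\lambda_n+1)^{-1}=\|t^{\lambda_n}\|_p^p$. A sequence $(u_n)_n$ of positive numbers is lacunary if there exists $r>1$ such that $u_{n+1}\ge ru_n$ for every $n$. A sequence $(u_n)_n$ is quasi-lacunary if there is an extraction (strictly increasing sequence of indices) $(n_k)_k$ such that $\sup_k(n_{k+1}-n_k)<+\infty$ and $(u_{n_k})_k$ is lacunary. *)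

theory Defs
  imports "HOL-Analysis.Analysis"
begin

definition lacunary :: "(nat \<Rightarrow> real) \<Rightarrow> bool" where
  "lacunary u \<longleftrightarrow> (\<forall>n. u n > 0) \<and> (\<exists>r>1. \<forall>n. u (Suc n) \<ge> r * u n)"

text \<open>The truncated subtraction below is harmless, as the extraction is strictly increasing.\<close>

definition quasi_lacunary :: "(nat \<Rightarrow> real) \<Rightarrow> bool" where
  "quasi_lacunary u \<longleftrightarrow>
     (\<exists>s :: nat \<Rightarrow> nat. strict_mono s \<and>
        bdd_above (range (\<lambda>k. s (Suc k) - s k)) \<and>
        lacunary (\<lambda>k. u (s k)))"

text \<open>Elements of $L^p([0,1])$ are represented by functions rather than by classes modulo
  equality almost everywhere; values outside $[0,1]$ play no role.\<close>

definition Lp_space :: "real \<Rightarrow> (real \<Rightarrow> complex) set" where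
  "Lp_space p = {f. f \<in> borel_measurable (lebesgue_on {0..1}) \<and>
                    integrable (lebesgue_on {0..1}) (\<lambda>t. norm (f t) powr p)}"

definition Lp_norm :: "real \<Rightarrow> (real \<Rightarrow> complex) \<Rightarrow> real" where
  "Lp_norm p f = (LINT t|lebesgue_on {0..1}. norm (f t) powr p) powr (1 / p)"

text \<open>The case distinction is there because \<^term>\<open>(0::real) powr 0 = 0\<close>.\<close>

definition monomial :: "real \<Rightarrow> real \<Rightarrow> complex" where
  "monomial l t = (if l = 0 then 1 else of_real (t powr l))"

definition muntz_polynomials :: "(nat \<Rightarrow> real) \<Rightarrow> (real \<Rightarrow> complex) set" where
  "muntz_polynomials \<Lambda> = {(\<lambda>t. \<Sum>n<N. c n * monomial (\<Lambda> n) t) | N c. True}"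

definition muntz_space :: "real \<Rightarrow> (nat \<Rightarrow> real) \<Rightarrow> (real \<Rightarrow> complex) set" where
  "muntz_space p \<Lambda> =
     {f \<in> Lp_space p. \<forall>\<epsilon>>0. \<exists>q \<in> muntz_polynomials \<Lambda>. Lp_norm p (\<lambda>t. f t - q t) < \<epsilon>}"

definition muntz_weight :: "real \<Rightarrow> (nat \<Rightarrow> real) \<Rightarrow> nat \<Rightarrow> real" where
  "muntz_weight p \<Lambda> n = 1 / (p * \<Lambda> n + 1)"

definition weighted_lp :: "real \<Rightarrow> (nat \<Rightarrow> real) \<Rightarrow> (nat \<Rightarrow> complex) set" where
  "weighted_lp p \<omega> = {b. summable (\<lambda>n. norm (b n) powr p * \<omega> n)}"

definition weighted_lp_norm :: "real \<Rightarrow> (nat \<Rightarrow> real) \<Rightarrow> (nat \<Rightarrow> complex) \<Rightarrow> real" where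
  "weighted_lp_norm p \<omega> b = (\<Sum>n. norm (b n) powr p * \<omega> n) powr (1 / p)"

text \<open>If $\inf_n (\lambda_{n+1} - \lambda_n) > 0$ and $b \in \ell^p(\omega)$ with
  $\omega_n = (p\lambda_n+1)^{-1}$, the series below converges absolutely for all
  $t \in [0,1)$: $\lambda_n$ grows at least linearly and
  $|b_n| \le \|b\| (p\lambda_n+1)^{1/p}$. So it determines a function almost everywhere on $[0,1]$.\<close>

definition muntz_series :: "(nat \<Rightarrow> real) \<Rightarrow> (nat \<Rightarrow> complex) \<Rightarrow> real \<Rightarrow> complex" where
  "muntz_series \<Lambda> b = (\<lambda>t. \<Sum>n. b n * monomial (\<Lambda> n) t)"

text \<open>An operator given on representatives is bounded from $\ell^p(\omega)$ to a subspace
  \<open>M\<close> of $L^p$ if it takes its values in \<open>M\<close> and satisfies a norm estimate. Linearity of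
  \<^const>\<open>muntz_series\<close> is clear from its definition and is not restated. Applied to tails of
  \<open>b\<close>, the estimate gives convergence of the series in $L^p$ norm as well.\<close>

definition bounded_operator_lp_Lp ::
    "real \<Rightarrow> (nat \<Rightarrow> real) \<Rightarrow> (real \<Rightarrow> complex) set \<Rightarrow>
     ((nat \<Rightarrow> complex) \<Rightarrow> real \<Rightarrow> complex) \<Rightarrow> bool" where
  "bounded_operator_lp_Lp p \<omega> M J \<longleftrightarrow>
     (\<forall>b \<in> weighted_lp p \<omega>. J b \<in> M) \<and>
     (\<exists>C. \<forall>b \<in> weighted_lp p \<omega>. Lp_norm p (J b) \<le> C * weighted_lp_norm p \<omega> b)"

end

theory Submission
  imports Defs
begin

text \<open>Put $u_n = \lambda_n + 1$. If $\Lambda$ is quasi-lacunary, then $u_{n+M} \ge \rho u_n$ for some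
  $M$ and $\rho > 1$, hence $\sum_n u_n^{1/p} t^{\lambda_n} \le A (1 - t)^{-1/p}$ on $(0,1)$. Jensen's
  inequality with the weights $u_n^{1/p} t^{\lambda_n}$ at the points $|b_n| u_n^{-1/p}$ gives
  \[ \Big(\sum_n |b_n| t^{\lambda_n}\Big)^p
     \le A^{p-1} (1 - t)^{1/p - 1} \sum_n |b_n|^p u_n^{1/p-1} t^{\lambda_n}, \]
  and integrating term by term bounds the operator, because
  $\int_0^1 t^{\lambda} (1 - t)^{1/p-1} dt = O((\lambda+1)^{-1/p})$. Conversely, testing a bounded
  operator on the indicator of a block of $N$ consecutive indices on which $\lambda$ at most doubles
  gives $N^{p-1} \le 2 C^p$, so $\lambda$ doubles within a bounded number of steps.\<close>

section \<open>Growth of quasi-lacunary sequences and the exponential sum they control\<close>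

text \<open>A bounded shift carries every index across a full step of the extraction, which gains
  the factor \<open>r\<close> for \<open>u\<close>. Where \<open>u\<close> is near 0 this says
  little about \<open>u + 1\<close>; there the additive gain \<delta> takes over.\<close>

lemma quasi_lacunary_imp_ratio:
  fixes u :: "nat \<Rightarrow> real"
  assumes "quasi_lacunary u" and "mono u" and nn: "\<And>n. 0 \<le> u n"
    and "0 < \<delta>" and gap: "\<And>n. u n + \<delta> \<le> u (Suc n)"
  obtains M \<rho> where "1 < \<rho>" "\<And>n. \<rho> * (u n + 1) \<le> u (n + M) + 1"
proof -
  obtain s where s: "strict_mono s" "bdd_above (range (\<lambda>k. s (Suc k) - s k))"
    and lac: "lacunary (\<lambda>k. u (s k))"
    using assms(1) by (auto simp: quasi_lacunary_def)
  obtain r where r: "1 < r" "\<And>k. r * u (s k) \<le> u (s (Suc k))"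
    using lac by (auto simp: lacunary_def)
  obtain K where K: "\<And>k. s (Suc k) - s k \<le> K"
    using s(2) by (auto simp: bdd_above_def)
  have step: "s (Suc k) \<le> s k + K" for k
    using K[of k] by linarith
  \<comment> \<open>The term \<open>s 0\<close> serves the indices before the extraction starts,
    \<open>2 * K\<close> leads from \<open>n \<ge> s k\<close> to \<open>s (Suc (Suc k))\<close>,
    and the final 1 makes the shift positive, so that the gap \<delta> can be used.\<close>
  define M where "M = s 0 + 2 * K + 1"
  have ratio: "r * u n \<le> u (n + M)" for n
  proof (cases "n < s 0")
    case True
    have "r * u n \<le> r * u (s 0)"
      using True r(1) \<open>mono u\<close> by (intro mult_left_mono) (auto simp: mono_def)
    also have "\<dots> \<le> u (s (Suc 0))" by (rule r)
    also have "\<dots> \<le> u (n + M)"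
      using step[of 0] by (intro monoD[OF \<open>mono u\<close>]) (auto simp: M_def)
    finally show ?thesis .
  next
    case False
    have "\<exists>k. s k \<le> n \<and> n < s (Suc k)"
    proof -
      have "n < s (Suc n)"
        using strict_mono_imp_increasing[OF s(1), of "Suc n"] by linarith
      then have "\<exists>k\<le>n. (\<forall>i\<le>k. \<not> n < s i) \<and> n < s (Suc k)"
        using ex_least_nat_less[of "\<lambda>k. n < s k" "Suc n"] False by (auto simp: less_Suc_eq_le)
      then show ?thesis by (auto simp: not_less)
    qed
    then obtain k where k: "s k \<le> n" "n < s (Suc k)" by blast
    have "r * u n \<le> r * u (s (Suc k))"
      using k r(1) \<open>mono u\<close> by (intro mult_left_mono) (auto simp: mono_def)
    also have "\<dots> \<le> u (s (Suc (Suc k)))" by (rule r)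
    also have "\<dots> \<le> u (n + M)"
      using step[of k] step[of "Suc k"] k
      by (intro monoD[OF \<open>mono u\<close>]) (auto simp: M_def)
    finally show ?thesis .
  qed
  have shift: "u n + \<delta> \<le> u (n + M)" for n
    using gap[of n] monoD[OF \<open>mono u\<close>, of "Suc n" "n + M"] by (simp add: M_def)
  \<comment> \<open>The estimates \<open>ratio\<close> and \<open>shift\<close> will be averaged:
    the excess \<open>\<epsilon> * u n\<close> is paid by half of the first, the excess \<epsilon>
    by half of the second.\<close>
  define \<epsilon> where "\<epsilon> = min ((r - 1) / 2) (\<delta> / 2)"
  have \<epsilon>: "0 < \<epsilon>" "\<epsilon> \<le> (r - 1) / 2" "\<epsilon> \<le> \<delta> / 2"
    using r(1) \<open>0 < \<delta>\<close> by (auto simp: \<epsilon>_def min_def)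
  have "(1 + \<epsilon>) * (u n + 1) \<le> u (n + M) + 1" for n
  proof -
    have "\<epsilon> * u n \<le> (r - 1) / 2 * u n"
      using \<epsilon> nn by (intro mult_right_mono) auto
    then have "(1 + \<epsilon>) * (u n + 1) \<le> (r * u n + (u n + \<delta>)) / 2 + 1"
      using \<epsilon>(3) by (simp add: field_simps)
    also have "\<dots> \<le> u (n + M) + 1"
      using ratio[of n] shift[of n] by simp
    finally show ?thesis .
  qed
  then show thesis using that[of "1 + \<epsilon>" M] \<epsilon>(1) by simp
qed

lemma sum_powr_exp_bound:
  fixes u :: "nat \<Rightarrow> real"
  assumes "1 < \<rho>" and pos: "\<And>n. 0 < u n" and ratio: "\<And>n. \<rho> * u n \<le> u (n + M)"
    and s: "0 < s" "s \<le> 1" and "0 < y"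
  shows "(\<Sum>n<N. u n powr s * exp (- (u n * y)))
           \<le> 4 * real M * (\<rho> powr s / (\<rho> powr s - 1)) * y powr (- s)"
proof -
  \<comment> \<open>As \<open>\<Phi>\<close> takes values in \<open>[0, 1]\<close>, the differences \<open>\<Phi> (u (n + M) * y) - \<Phi> (u n * y)\<close> telescope to a sum
    of at most \<open>M\<close>, and each of them dominates a multiple of the corresponding summand.\<close>
  define \<Phi> :: "real \<Rightarrow> real" where "\<Phi> x = x powr s / (1 + x powr s)" for x
  have \<Phi>01: "0 \<le> \<Phi> x" "\<Phi> x \<le> 1" for x
    by (auto simp: \<Phi>_def divide_le_eq_1 add_pos_nonneg)
  define R where "R = \<rho> powr s"
  have R: "1 < R" using assms by (simp add: R_def)
  \<comment> \<open>The 4 comes from \<open>(1 + X)\<^sup>2 \<le> 4 * exp x\<close>. The factor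
    \<open>R / (R - 1)\<close> is the cost of comparing \<open>X / (1 + X)\<^sup>2\<close> with
    \<open>(R - 1) * X / ((1 + X) * (1 + R * X))\<close>, which is the increment of \<Phi> from
    \<open>x\<close> to \<open>\<rho> * x\<close>.\<close>
  define c where "c = 4 * (R / (R - 1))"
  have c: "0 < c" using R by (simp add: c_def)
  have summand: "(u n * y) powr s * exp (- (u n * y)) \<le> c * (\<Phi> (u (n + M) * y) - \<Phi> (u n * y))" for n
  proof -
    define x where "x = u n * y"
    define X where "X = x powr s"
    have x: "0 < x" using pos \<open>0 < y\<close> by (simp add: x_def)
    have X: "0 < X" using x by (simp add: X_def)
    \<comment> \<open>Since \<open>s \<le> 1\<close>, \<open>X\<close> is at most
      \<open>max 1 x\<close>. The bound is then written with \<open>exp (x / 2)\<close> so that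
      squaring produces \<open>exp x\<close>.\<close>
    have "X \<le> max 1 x powr s"
      unfolding X_def using s x by (intro powr_mono2) auto
    also have "\<dots> \<le> max 1 x powr 1" using s by (intro powr_mono) auto
    finally have "1 + X \<le> 2 * (1 + x / 2)" using x by (simp add: max_def split: if_splits)
    also have "\<dots> \<le> 2 * exp (x / 2)"
      by (rule mult_left_mono) simp_all
    finally have "(1 + X)\<^sup>2 \<le> (2 * exp (x / 2))\<^sup>2"
      using X by (intro power_mono) auto
    also have "\<dots> = 4 * exp x"
      by (simp add: power_mult_distrib exp_double[symmetric])
    finally have e: "exp (- x) * (1 + X)\<^sup>2 \<le> 4"
      by (simp add: exp_minus divide_simps)
    have "X * exp (- x) \<le> 4 * X / (1 + X)\<^sup>2"
      using mult_left_mono[OF e, of X] X by (simp add: pos_le_divide_eq ac_simps)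
    also have "\<dots> = c * ((R - 1) / R * (X / (1 + X)\<^sup>2))"
      using R by (simp add: c_def)
    also have "\<dots> \<le> c * ((R - 1) * X / ((1 + X) * (1 + R * X)))"
    proof (rule mult_left_mono)
      have "(1 + X) * (1 + R * X) \<le> R * (1 + X)\<^sup>2"
        using mult_left_mono[of "1 + R * X" "R * (1 + X)" "1 + X"] R X
        by (simp add: power2_eq_square algebra_simps)
      then show "(R - 1) / R * (X / (1 + X)\<^sup>2) \<le> (R - 1) * X / ((1 + X) * (1 + R * X))"
        unfolding times_divide_times_eq using R X
          by (intro divide_left_mono mult_pos_pos zero_less_power add_pos_pos mult_nonneg_nonneg) auto
    qed (use c in simp)
    also have "(R - 1) * X / ((1 + X) * (1 + R * X)) = \<Phi> (\<rho> * x) - \<Phi> x"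
    proof -
      have "\<Phi> (\<rho> * x) = R * X / (1 + R * X)" "\<Phi> x = X / (1 + X)"
        using x \<open>1 < \<rho>\<close> by (simp_all add: \<Phi>_def R_def X_def powr_mult)
      moreover have "(R - 1) * X / ((1 + X) * (1 + R * X)) = R * X / (1 + R * X) - X / (1 + X)"
      proof -
        have "1 + X > 0" "1 + R * X > 0" using R X by (auto intro!: add_pos_pos)
        then show ?thesis by (subst diff_frac_eq) (auto simp: algebra_simps)
      qed
      ultimately show ?thesis by simp
    qed
    also have "\<Phi> (\<rho> * x) \<le> \<Phi> (u (n + M) * y)"
    proof -
      have "\<rho> * x \<le> u (n + M) * y"
        using mult_right_mono[OF ratio[of n], of y] \<open>0 < y\<close> by (simp add: x_def mult.assoc)
      then have "(\<rho> * x) powr s \<le> (u (n + M) * y) powr s"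
        using x \<open>1 < \<rho>\<close> s by (intro powr_mono2) auto
      moreover have "a / (1 + a) \<le> b / (1 + b)" if "0 \<le> a" "a \<le> b" for a b :: real
        using that by (simp add: field_simps)
      ultimately show ?thesis by (simp add: \<Phi>_def)
    qed
    finally show ?thesis using c by (simp add: x_def X_def)
  qed
  have tele: "(\<Sum>n<N. \<Phi> (u (n + M) * y) - \<Phi> (u n * y)) \<le> real M"
  proof -
    define g where "g n = \<Phi> (u n * y)" for n
    have "(\<Sum>n<N. g (n + M)) = (\<Sum>n\<in>{M..<N + M}. g n)"
      using sum.shift_bounds_nat_ivl[of g 0 M N] by (simp add: atLeast0LessThan)
    moreover have "(\<Sum>n\<in>{M..<N + M}. g n) + (\<Sum>n<M. g n) = (\<Sum>n<N + M. g n)"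
      using sum.atLeastLessThan_concat[of 0 M "N + M" g] by (simp add: atLeast0LessThan add.commute)
    moreover have "(\<Sum>n<N. g n) + (\<Sum>n\<in>{N..<N + M}. g n) = (\<Sum>n<N + M. g n)"
      using sum.atLeastLessThan_concat[of 0 N "N + M" g] by (simp add: atLeast0LessThan)
    moreover have "(\<Sum>n\<in>{N..<N + M}. g n) \<le> real M"
      using sum_bounded_above[of "{N..<N + M}" g 1] \<Phi>01 by (simp add: g_def)
    moreover have "0 \<le> (\<Sum>n<M. g n)" using \<Phi>01 by (auto simp: g_def intro: sum_nonneg)
    ultimately show ?thesis by (simp add: sum_subtractf flip: g_def)
  qed
  \<comment> \<open>Taking out \<open>y powr (- s)\<close> leaves terms that depend on
    \<open>u n * y\<close> only, as in \<open>summand\<close>.\<close>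
  have "(\<Sum>n<N. u n powr s * exp (- (u n * y)))
      = y powr (- s) * (\<Sum>n<N. (u n * y) powr s * exp (- (u n * y)))"
    unfolding sum_distrib_left using \<open>0 < y\<close> pos
    by (intro sum.cong refl) (simp add: powr_mult powr_minus less_imp_le field_simps)
  also have "\<dots> \<le> y powr (- s) * (\<Sum>n<N. c * (\<Phi> (u (n + M) * y) - \<Phi> (u n * y)))"
    using summand by (intro mult_left_mono sum_mono) auto
  also have "\<dots> \<le> y powr (- s) * (c * real M)"
    using tele c by (intro mult_left_mono) (auto simp: sum_distrib_left[symmetric])
  finally show ?thesis by (simp add: c_def R_def ac_simps)
qed

section \<open>Jensen's inequality for powers\<close>

text \<open>This is convexity of the power function for the normalised weights
  \<open>w i / W\<close>; undoing the normalisation costs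
  \<open>W powr p / W = W powr (p - 1)\<close>.\<close>

lemma powr_sum_Jensen:
  fixes w x :: "'a \<Rightarrow> real"
  assumes "finite S" and "1 \<le> p" and w: "\<And>i. i \<in> S \<Longrightarrow> 0 < w i" and x: "\<And>i. i \<in> S \<Longrightarrow> 0 \<le> x i"
  shows "(\<Sum>i\<in>S. w i * x i) powr p \<le> (\<Sum>i\<in>S. w i) powr (p - 1) * (\<Sum>i\<in>S. w i * x i powr p)"
proof -
  \<comment> \<open>Convexity is applied at positive points only. Since \<open>0 powr p = 0\<close>,
    discarding the others changes neither sum, and it can only lower the total weight, which is
    harmless because \<open>p - 1 \<ge> 0\<close>.\<close>
  define T where "T = {i \<in> S. 0 < x i}"
  have T: "finite T" "T \<subseteq> S" using \<open>finite S\<close> by (auto simp: T_def)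
  have S0: "i \<in> S - T \<Longrightarrow> x i = 0" for i using x[of i] by (auto simp: T_def)
  have eq: "(\<Sum>i\<in>S. w i * x i) = (\<Sum>i\<in>T. w i * x i)"
    "(\<Sum>i\<in>S. w i * x i powr p) = (\<Sum>i\<in>T. w i * x i powr p)"
    using S0 T \<open>finite S\<close> by (auto intro!: sum.mono_neutral_right)
  show ?thesis
  proof (cases "T = {}")
    case True
    then show ?thesis by (simp add: eq)
  next
    case False
    define W where "W = (\<Sum>i\<in>T. w i)"
    have W: "0 < W" unfolding W_def using T w False by (intro sum_pos) auto
    have "(\<Sum>i\<in>T. (w i / W) *\<^sub>R x i) powr p \<le> (\<Sum>i\<in>T. (w i / W) * x i powr p)"
      using T W w False \<open>1 \<le> p\<close>
      by (intro convex_on_sum[OF T(1) False powr_convex])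
         (auto simp: T_def W_def less_imp_le sum_divide_distrib[symmetric])
    then have "((\<Sum>i\<in>T. w i * x i) / W) powr p \<le> (\<Sum>i\<in>T. w i * x i powr p) / W"
      by (simp add: sum_divide_distrib)
    moreover have "0 \<le> (\<Sum>i\<in>T. w i * x i)"
      using T x w by (intro sum_nonneg mult_nonneg_nonneg) (auto simp: less_imp_le)
    ultimately have "(\<Sum>i\<in>T. w i * x i) powr p \<le> W powr p * ((\<Sum>i\<in>T. w i * x i powr p) / W)"
      using W by (simp add: powr_divide field_simps)
    also have "\<dots> = W powr (p - 1) * (\<Sum>i\<in>T. w i * x i powr p)"
      using W by (simp add: powr_diff)
    also have "\<dots> \<le> (\<Sum>i\<in>S. w i) powr (p - 1) * (\<Sum>i\<in>T. w i * x i powr p)"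
    proof (intro mult_right_mono powr_mono2)
      show "W \<le> (\<Sum>i\<in>S. w i)" unfolding W_def
        using T \<open>finite S\<close> w by (intro sum_mono2) (auto simp: less_imp_le)
      show "0 \<le> (\<Sum>i\<in>T. w i * x i powr p)"
        using T w by (intro sum_nonneg mult_nonneg_nonneg) (auto simp: less_imp_le)
    qed (use W \<open>1 \<le> p\<close> in auto)
    finally show ?thesis by (simp add: eq)
  qed
qed

section \<open>Integrals over the unit interval\<close>

lemma nn_integral_lebesgue_on_has_integral:
  fixes f :: "real \<Rightarrow> real"
  assumes "\<Omega> \<in> sets lebesgue" "\<And>x. x \<in> \<Omega> \<Longrightarrow> 0 \<le> f x" "(f has_integral I) \<Omega>"
  shows "(\<integral>\<^sup>+x. ennreal (f x) \<partial>lebesgue_on \<Omega>) = ennreal I"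
  using assms nn_integral_has_integral_lebesgue'[OF assms(2,3)]
  by (simp add: nn_integral_restrict_space nn_integral_completion)

lemma borel_measurable_lebesgue_on:
  "f \<in> borel_measurable borel \<Longrightarrow> f \<in> borel_measurable (lebesgue_on S)"
  by (simp add: measurable_restrict_space1 measurable_completion)

text \<open>Both endpoints are null. Dropping them avoids the conventional value of powers at 0 and
  the singularity of negative powers of \<open>1 - t\<close> at 1.\<close>

lemma AE_unit_interval: "AE t in lebesgue_on {0..1::real}. 0 < t \<and> t < 1"
proof -
  have "AE t in lebesgue. t \<noteq> (0::real)" "AE t in lebesgue. t \<noteq> (1::real)"
    by (intro AE_completion AE_lborel_singleton)+
  then show ?thesis by (subst AE_restrict_space_iff) auto
qed

text \<open>The integral is the Beta value B(l + 1, 1 - a). Only its order of decay in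
  \<open>l\<close> matters, and cutting at distance \<open>1 / (l + 1)\<close> from the right end
  gives two pieces of that order.\<close>

lemma nn_integral_powr_beta_le:
  fixes a l :: real
  assumes "0 \<le> l" and a: "0 \<le> a" "a < 1"
  shows "(\<integral>\<^sup>+t. ennreal (t powr l * (1 - t) powr (- a)) \<partial>lebesgue_on {0..1})
           \<le> ennreal ((1 + 1 / (1 - a)) * (l + 1) powr (a - 1))"
proof -
  define \<mu> where "\<mu> = l + 1"
  have \<mu>: "1 \<le> \<mu>" using assms by (simp add: \<mu>_def)
  \<comment> \<open>The first factor is at most 1 beyond \<open>d\<close>, and the second at most \<open>\<mu> powr a\<close> before it.\<close>
  define d where "d = 1 - 1 / \<mu>"
  have d: "0 \<le> d" "d < 1" using \<mu> by (simp_all add: d_def)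
  have I1: "(\<integral>\<^sup>+t. ennreal (\<mu> powr a * t powr l) \<partial>lebesgue_on {0..1}) = ennreal (\<mu> powr (a - 1))"
  proof -
    have "((\<lambda>t. \<mu> powr a * t powr l) has_integral \<mu> powr a * (1 powr (l + 1) / (l + 1))) {0..1}"
      using assms by (intro has_integral_mult_right has_integral_powr_from_0) auto
    then show ?thesis
      using \<mu> by (subst nn_integral_lebesgue_on_has_integral[of _ _ "\<mu> powr (a - 1)"])
        (auto simp: powr_diff \<mu>_def)
  qed
  define h where "h t = (if t \<in> {d..1} then (1 - t) powr (- a) else 0)" for t
  have h0: "0 \<le> h t" for t by (simp add: h_def)
  have I2: "(\<integral>\<^sup>+t. ennreal (h t) \<partial>lebesgue_on {0..1}) = ennreal (1 / (1 - a) * \<mu> powr (a - 1))"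
  proof -
    \<comment> \<open>For \<open>a > 0\<close> the integrand blows up towards 1, but its primitive
      is continuous up to 1 because \<open>1 - a > 0\<close>; hence the fundamental theorem with
      derivatives in the interior only.\<close>
    have "((\<lambda>t. (1 - t) powr (- a)) has_integral
        (- ((1 - 1) powr (1 - a) / (1 - a)) - - ((1 - d) powr (1 - a) / (1 - a)))) {d..1}"
    proof (rule fundamental_theorem_of_calculus_interior)
      show "continuous_on {d..1} (\<lambda>t. - ((1 - t) powr (1 - a) / (1 - a)))"
        using a by (auto intro!: continuous_intros continuous_on_powr')
      fix t assume "t \<in> {d<..<1}"
      then show "((\<lambda>t. - ((1 - t) powr (1 - a) / (1 - a))) has_vector_derivative (1 - t) powr (- a)) (at t)"
        unfolding has_real_derivative_iff_has_vector_derivative[symmetric] using a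
        by (auto intro!: derivative_eq_intros DERIV_chain2[OF has_real_derivative_powr])
    qed (use d in simp)
    also have "(- ((1 - 1) powr (1 - a) / (1 - a)) - - ((1 - d) powr (1 - a) / (1 - a)))
        = 1 / (1 - a) * \<mu> powr (a - 1)"
      using \<mu> by (simp add: d_def powr_divide powr_diff)
    finally have "((\<lambda>t. (1 - t) powr (- a)) has_integral (1 / (1 - a) * \<mu> powr (a - 1))) {d..1}" .
    then have hI: "(h has_integral (1 / (1 - a) * \<mu> powr (a - 1))) {0..1}"
      unfolding h_def using d by (subst has_integral_restrict) auto
    show ?thesis
      by (rule nn_integral_lebesgue_on_has_integral[OF _ _ hI]) (auto simp: h_def)
  qed
  have "h \<in> borel_measurable borel" unfolding h_def by measurable
  then have m2: "h \<in> borel_measurable (lebesgue_on {0..1})"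
    by (rule borel_measurable_lebesgue_on)
  have m1: "(\<lambda>t. \<mu> powr a * t powr l) \<in> borel_measurable (lebesgue_on {0..1})"
    by (rule borel_measurable_lebesgue_on) measurable
  have "(\<integral>\<^sup>+t. ennreal (t powr l * (1 - t) powr (- a)) \<partial>lebesgue_on {0..1})
      \<le> (\<integral>\<^sup>+t. ennreal (\<mu> powr a * t powr l) + ennreal (h t) \<partial>lebesgue_on {0..1})"
  proof (intro nn_integral_mono)
    fix t :: real assume "t \<in> space (lebesgue_on {0..1})"
    then have t: "0 \<le> t" "t \<le> 1" by auto
    have le: "t powr l * (1 - t) powr (- a) \<le> \<mu> powr a * t powr l + h t"
    proof (cases "t < d")
      case True
      then have "1 / \<mu> \<le> 1 - t" by (simp add: d_def)
      then have "(1 - t) powr (- a) \<le> (1 / \<mu>) powr (- a)"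
        using a \<mu> by (intro powr_mono2') auto
      also have "\<dots> = \<mu> powr a" using \<mu> by (simp add: powr_divide powr_minus_divide)
      finally have "t powr l * (1 - t) powr (- a) \<le> t powr l * \<mu> powr a"
        by (rule mult_left_mono) simp
      then show ?thesis using True by (simp add: h_def mult.commute)
    next
      case False
      have "t powr l \<le> 1" using t assms by (simp add: powr_le1)
      then have "t powr l * (1 - t) powr (- a) \<le> h t"
        using False t mult_right_mono[of "t powr l" 1 "(1 - t) powr (- a)"] by (simp add: h_def)
      moreover have "0 \<le> \<mu> powr a * t powr l" by simp
      ultimately show ?thesis by linarith
    qed
    have "0 \<le> \<mu> powr a * t powr l" by simp
    from ennreal_plus[OF this h0] ennreal_leI[OF le]
    show "ennreal (t powr l * (1 - t) powr (- a)) \<le> ennreal (\<mu> powr a * t powr l) + ennreal (h t)"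
      by (rule ord_le_eq_trans[rotated])
  qed
  also have "\<dots> = ennreal (\<mu> powr (a - 1)) + ennreal (1 / (1 - a) * \<mu> powr (a - 1))"
    unfolding I1[symmetric] I2[symmetric]
    by (rule nn_integral_add[OF measurable_compose[OF m1 measurable_ennreal]
      measurable_compose[OF m2 measurable_ennreal]])
  also have "\<dots> = ennreal (\<mu> powr (a - 1) + 1 / (1 - a) * \<mu> powr (a - 1))"
    using a by (intro ennreal_plus[symmetric]) auto
  also have "\<mu> powr (a - 1) + 1 / (1 - a) * \<mu> powr (a - 1) = (1 + 1 / (1 - a)) * (l + 1) powr (a - 1)"
    by (simp add: \<mu>_def distrib_right)
  finally show ?thesis .
qed


section \<open>Measurability, norms and weights\<close>

lemma monomial_pos: "0 < t \<Longrightarrow> monomial l t = of_real (t powr l)"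
  by (simp add: monomial_def)

lemma monomial_measurable [measurable]: "monomial l \<in> borel_measurable (lebesgue_on {0..1})"
proof -
  have "monomial l \<in> borel_measurable borel"
    unfolding monomial_def[abs_def] by measurable
  then show ?thesis by (rule borel_measurable_lebesgue_on)
qed

lemma muntz_series_measurable [measurable]:
  "muntz_series \<Lambda> b \<in> borel_measurable (lebesgue_on {0..1})"
  unfolding muntz_series_def by measurable

lemma Lp_space_normI:
  assumes "f \<in> borel_measurable (lebesgue_on {0..1})" "0 < p" "0 \<le> I"
    and le: "(\<integral>\<^sup>+t. ennreal (norm (f t) powr p) \<partial>lebesgue_on {0..1}) \<le> ennreal I"
  shows "f \<in> Lp_space p" "Lp_norm p f \<le> I powr (1 / p)"
proof -
  note assms(1) [measurable]
  have int: "integrable (lebesgue_on {0..1}) (\<lambda>t. norm (f t) powr p)"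
    using le by (intro integrableI_nonneg) (auto simp: le_less_trans)
  then show "f \<in> Lp_space p" by (simp add: Lp_space_def)
  have "(LINT t|lebesgue_on {0..1}. norm (f t) powr p) \<le> I"
    using le nn_integral_eq_integral[OF int] \<open>0 \<le> I\<close> by simp
  then show "Lp_norm p f \<le> I powr (1 / p)"
    unfolding Lp_norm_def using \<open>0 < p\<close> by (intro powr_mono2) (auto intro: integral_nonneg)
qed

text \<open>As \<open>p > 1\<close>, \<open>p * \<Lambda> n + 1 \<le> p * (\<Lambda> n + 1)\<close>.
  Estimates can thus be made with \<open>\<Lambda> n + 1\<close> and converted to the weight at the
  cost of a factor \<open>p\<close>.\<close>

lemma inverse_le_muntz_weight:
  assumes "1 < p" "0 \<le> \<Lambda> n"
  shows "1 / (\<Lambda> n + 1) \<le> p * muntz_weight p \<Lambda> n"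
  using assms by (simp add: muntz_weight_def field_simps add_pos_nonneg)

lemma muntz_weight_nonneg: "1 < p \<Longrightarrow> 0 \<le> \<Lambda> n \<Longrightarrow> 0 \<le> muntz_weight p \<Lambda> n"
  by (simp add: muntz_weight_def)

section \<open>Boundedness of the operator from the kernel bound\<close>

text \<open>Jensen's inequality at a fixed point \<open>t\<close>, where \<open>A\<close> may depend
  on \<open>t\<close>. Convergence is included because an infinite sum has its intended value only
  for summable terms.\<close>

lemma muntz_series_pointwise:
  assumes p: "1 < p" and \<Lambda>: "\<And>n. 0 \<le> \<Lambda> n" and t: "0 < t"
    and A: "\<And>N. (\<Sum>n<N. (\<Lambda> n + 1) powr (1 / p) * t powr \<Lambda> n) \<le> A"
    and b: "b \<in> weighted_lp p (muntz_weight p \<Lambda>)"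
  defines "g \<equiv> \<lambda>n. norm (b n) powr p * (\<Lambda> n + 1) powr (1 / p - 1) * t powr \<Lambda> n"
  shows "summable g" "summable (\<lambda>n. b n * monomial (\<Lambda> n) t)"
    "norm (muntz_series \<Lambda> b t) powr p \<le> A powr (p - 1) * (\<Sum>n. g n)"
proof -
  define u where "u n = \<Lambda> n + 1" for n
  have u: "0 < u n" for n using \<Lambda>[of n] by (simp add: u_def)
  define w where "w n = u n powr (1 / p) * t powr \<Lambda> n" for n
  have w: "0 < w n" for n using u[of n] t by (simp add: w_def)
  have A': "(\<Sum>n<N. w n) \<le> A" for N using A[of N] by (simp add: w_def u_def)
  have wA: "w n \<le> A" for n
  proof -
    have "w n \<le> (\<Sum>k<Suc n. w k)"
      using w by (intro member_le_sum) (auto simp: less_imp_le)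
    then show ?thesis using A'[of "Suc n"] by linarith
  qed
  have A0: "0 \<le> A" using A'[of 0] by simp
  define x where "x n = norm (b n) * u n powr (- 1 / p)" for n
  have wx: "w n * x n = norm (b n * monomial (\<Lambda> n) t)" for n
    using u[of n] t
    by (simp add: w_def x_def monomial_pos norm_mult powr_minus field_simps)
  have "x n powr p = norm (b n) powr p * u n powr (- 1)" for n
    using p u[of n] by (simp add: x_def powr_mult powr_powr)
  then have wxp: "w n * x n powr p = g n" for n
    using u[of n] unfolding g_def u_def[symmetric]
    by (simp add: w_def powr_diff powr_minus divide_inverse)
  have gw: "g n = norm (b n) powr p * (1 / u n) * w n" for n
    using u[of n] unfolding g_def u_def[symmetric]
    by (simp add: w_def powr_diff)
  have g0: "0 \<le> g n" for n by (simp add: g_def)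
  \<comment> \<open>In the form \<open>gw\<close>, the bounds \<open>w n \<le> A\<close> and
    \<open>1 / u n \<le> p * muntz_weight p \<Lambda> n\<close> make a multiple of the series
    defining the weighted norm a majorant.\<close>
  show sg: "summable g"
  proof (rule summable_comparison_test')
    show "summable (\<lambda>n. (p * A) * (norm (b n) powr p * muntz_weight p \<Lambda> n))"
      using b by (intro summable_mult) (simp add: weighted_lp_def)
    fix n
    have "g n \<le> norm (b n) powr p * (p * muntz_weight p \<Lambda> n) * A"
      unfolding gw using inverse_le_muntz_weight[of p \<Lambda> n] p \<Lambda> wA w[of n] u[of n] muntz_weight_nonneg[of p \<Lambda> n]
      by (intro mult_mono) (auto simp: u_def less_imp_le)
    then show "norm (g n) \<le> (p * A) * (norm (b n) powr p * muntz_weight p \<Lambda> n)"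
      using g0[of n] by (simp add: ac_simps)
  qed
  define B where "B = A powr (p - 1) * (\<Sum>n. g n)"
  \<comment> \<open>Jensen for finite sums bounds all partial sums of moduli at once; this gives
    both absolute convergence and the final estimate.\<close>
  have partial: "(\<Sum>n<N. norm (b n * monomial (\<Lambda> n) t)) \<le> B powr (1 / p)" for N
  proof -
    have "(\<Sum>n<N. w n * x n) powr p \<le> (\<Sum>n<N. w n) powr (p - 1) * (\<Sum>n<N. w n * x n powr p)"
      using w p by (intro powr_sum_Jensen) (auto simp: x_def)
    also have "\<dots> \<le> B"
      unfolding wxp B_def using p A' w g0 sum_le_suminf[OF sg, of "{..<N}"]
      by (intro mult_mono powr_mono2) (auto intro!: sum_nonneg simp: less_imp_le)
    finally have "((\<Sum>n<N. w n * x n) powr p) powr (1 / p) \<le> B powr (1 / p)"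
      using p by (intro powr_mono2) auto
    moreover have "0 \<le> (\<Sum>n<N. w n * x n)" unfolding wx by (intro sum_nonneg) simp
    ultimately show ?thesis using p by (simp add: powr_powr wx)
  qed
  have sn: "summable (\<lambda>n. norm (b n * monomial (\<Lambda> n) t))"
    by (rule summableI_nonneg_bounded[OF _ partial]) simp
  then show "summable (\<lambda>n. b n * monomial (\<Lambda> n) t)" by (rule summable_norm_cancel)
  have "norm (muntz_series \<Lambda> b t) \<le> (\<Sum>n. norm (b n * monomial (\<Lambda> n) t))"
    unfolding muntz_series_def by (rule summable_norm[OF sn])
  also have "\<dots> \<le> B powr (1 / p)" by (rule suminf_le_const[OF sn partial])
  finally have "norm (muntz_series \<Lambda> b t) powr p \<le> (B powr (1 / p)) powr p"
    using p by (intro powr_mono2) auto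
  also have "\<dots> = B"
    using p suminf_nonneg[OF sg g0] by (simp add: powr_powr B_def)
  finally show "norm (muntz_series \<Lambda> b t) powr p \<le> A powr (p - 1) * (\<Sum>n. g n)"
    by (simp add: B_def)
qed

lemma muntz_series_Lp_bound:
  assumes p: "1 < p" and \<Lambda>: "\<And>n. 0 \<le> \<Lambda> n"
    and A: "\<And>N t. 0 < t \<Longrightarrow> t < 1 \<Longrightarrow>
      (\<Sum>n<N. (\<Lambda> n + 1) powr (1 / p) * t powr \<Lambda> n) \<le> A * (1 - t) powr (- 1 / p)"
    and b: "b \<in> weighted_lp p (muntz_weight p \<Lambda>)"
  shows "muntz_series \<Lambda> b \<in> Lp_space p"
    "Lp_norm p (muntz_series \<Lambda> b)
      \<le> (A powr (p - 1) * (1 + p) * p) powr (1 / p) * weighted_lp_norm p (muntz_weight p \<Lambda>) b"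
proof -
  \<comment> \<open>Raising \<open>(1 - t) powr (- 1 / p)\<close> to the power \<open>p - 1\<close>
    gives \<open>(1 - t) powr (- a)\<close>.\<close>
  define a where "a = 1 - 1 / p"
  have a: "0 \<le> a" "a < 1" using p by (auto simp: a_def)
  define S where "S = (\<Sum>n. norm (b n) powr p * muntz_weight p \<Lambda> n)"
  have sS: "summable (\<lambda>n. norm (b n) powr p * muntz_weight p \<Lambda> n)"
    using b by (simp add: weighted_lp_def)
  have S0: "0 \<le> S" unfolding S_def
    using p \<Lambda> by (intro suminf_nonneg[OF sS] mult_nonneg_nonneg muntz_weight_nonneg) auto
  \<comment> \<open>The factors come from Jensen, from the Beta estimate with
    \<open>1 / (1 - a) = p\<close>, and from the passage to the weight.\<close>
  define K where "K = A powr (p - 1) * (1 + p) * p"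
  have K0: "0 \<le> K" using p by (simp add: K_def)
  \<comment> \<open>The empty sum at \<open>t = 1/2\<close> shows that \<open>A\<close> is
    nonnegative.\<close>
  have "0 \<le> A * (1 - 1/2) powr (- 1 / p)" using A[of "1/2" 0] by simp
  then have A0: "0 \<le> A" by (simp add: zero_le_mult_iff)
  define c where "c n = A powr (p - 1) * (norm (b n) powr p * (\<Lambda> n + 1) powr (1 / p - 1))" for n
  have c0: "0 \<le> c n" for n by (simp add: c_def)
  define k where "k n t = t powr \<Lambda> n * (1 - t) powr (- a)" for n t
  have [measurable]: "k n \<in> borel_measurable (lebesgue_on {0..1})" for n
    unfolding k_def by (rule borel_measurable_lebesgue_on) measurable
  have pw: "ennreal (norm (muntz_series \<Lambda> b t) powr p) \<le> (\<Sum>n. ennreal (c n) * ennreal (k n t))"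
    if t: "0 < t" "t < 1" for t
  proof -
    define A' where "A' = A * (1 - t) powr (- 1 / p)"
    have pt: "A' powr (p - 1) = A powr (p - 1) * (1 - t) powr (- a)"
      using t p A0 by (simp add: A'_def powr_mult powr_powr a_def field_simps)
    note * = muntz_series_pointwise[OF p \<Lambda> t(1) A[OF t] b]
    have "norm (muntz_series \<Lambda> b t) powr p
        \<le> A' powr (p - 1) * (\<Sum>n. norm (b n) powr p * (\<Lambda> n + 1) powr (1 / p - 1) * t powr \<Lambda> n)"
      using *(3) by (simp add: A'_def)
    also have "\<dots> = (\<Sum>n. c n * k n t)"
      unfolding suminf_mult[OF *(1), symmetric] pt
      by (simp add: c_def k_def ac_simps)
    finally have "ennreal (norm (muntz_series \<Lambda> b t) powr p) \<le> ennreal (\<Sum>n. c n * k n t)"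
      by (rule ennreal_leI)
    also have "\<dots> = (\<Sum>n. ennreal (c n * k n t))"
    proof (rule suminf_ennreal2[symmetric])
      show "summable (\<lambda>n. c n * k n t)"
        using summable_mult[OF *(1), of "A' powr (p - 1)"]
        unfolding pt by (simp add: c_def k_def ac_simps)
    qed (simp add: c_def k_def)
    finally show ?thesis by (simp add: ennreal_mult c0 k_def)
  qed
  \<comment> \<open>For nonnegative extended values, sum and integral may be exchanged before any
    integrability is known.\<close>
  have "(\<integral>\<^sup>+t. ennreal (norm (muntz_series \<Lambda> b t) powr p) \<partial>lebesgue_on {0..1})
      \<le> (\<integral>\<^sup>+t. (\<Sum>n. ennreal (c n) * ennreal (k n t)) \<partial>lebesgue_on {0..1})"
    by (rule nn_integral_mono_AE) (use AE_unit_interval in eventually_elim, use pw in auto)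
  also have "\<dots> = (\<Sum>n. \<integral>\<^sup>+t. ennreal (c n) * ennreal (k n t) \<partial>lebesgue_on {0..1})"
    by (rule nn_integral_suminf) measurable
  also have "\<dots> = (\<Sum>n. ennreal (c n) * (\<integral>\<^sup>+t. ennreal (k n t) \<partial>lebesgue_on {0..1}))"
    by (intro suminf_cong nn_integral_cmult) measurable
  also have "\<dots> \<le> (\<Sum>n. ennreal (K * (norm (b n) powr p * muntz_weight p \<Lambda> n)))"
  proof (intro suminf_le summableI)
    fix n
    have u: "0 < \<Lambda> n + 1" using \<Lambda>[of n] by simp
    have "ennreal (c n) * (\<integral>\<^sup>+t. ennreal (k n t) \<partial>lebesgue_on {0..1})
        \<le> ennreal (c n) * ennreal ((1 + 1 / (1 - a)) * (\<Lambda> n + 1) powr (a - 1))"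
      unfolding k_def using \<Lambda> a by (intro mult_left_mono nn_integral_powr_beta_le) auto
    also have "\<dots> = ennreal (c n * ((1 + 1 / (1 - a)) * (\<Lambda> n + 1) powr (a - 1)))"
      using c0 a by (intro ennreal_mult[symmetric]) auto
    also have "c n * ((1 + 1 / (1 - a)) * (\<Lambda> n + 1) powr (a - 1))
        = A powr (p - 1) * (1 + p) * norm (b n) powr p * (1 / (\<Lambda> n + 1))"
    proof -
      \<comment> \<open>As \<open>a - 1 = - 1 / p\<close>, the exponents add up to -1.\<close>
      have "(\<Lambda> n + 1) powr (1 / p - 1) * (\<Lambda> n + 1) powr (a - 1) = 1 / (\<Lambda> n + 1)"
        using u unfolding powr_add[symmetric] by (simp add: a_def powr_minus_divide)
      then show ?thesis using p by (simp add: c_def a_def ac_simps)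
    qed
    also have "\<dots> \<le> A powr (p - 1) * (1 + p) * norm (b n) powr p * (p * muntz_weight p \<Lambda> n)"
      using inverse_le_muntz_weight[OF p \<Lambda>] p by (intro mult_left_mono) auto
    also have "\<dots> = K * (norm (b n) powr p * muntz_weight p \<Lambda> n)" by (simp add: K_def)
    finally show "ennreal (c n) * (\<integral>\<^sup>+t. ennreal (k n t) \<partial>lebesgue_on {0..1})
        \<le> ennreal (K * (norm (b n) powr p * muntz_weight p \<Lambda> n))"
      by (simp add: ennreal_leI)
  qed
  also have "\<dots> = ennreal (\<Sum>n. K * (norm (b n) powr p * muntz_weight p \<Lambda> n))"
    using K0 p \<Lambda> by (intro suminf_ennreal2 summable_mult sS) (simp add: muntz_weight_nonneg)
  also have "(\<Sum>n. K * (norm (b n) powr p * muntz_weight p \<Lambda> n)) = K * S"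
    by (simp add: S_def suminf_mult[OF sS])
  finally have le: "(\<integral>\<^sup>+t. ennreal (norm (muntz_series \<Lambda> b t) powr p) \<partial>lebesgue_on {0..1})
      \<le> ennreal (K * S)" .
  note Lp = Lp_space_normI[OF muntz_series_measurable _ _ le]
  show "muntz_series \<Lambda> b \<in> Lp_space p" using Lp(1) p K0 S0 by simp
  show "Lp_norm p (muntz_series \<Lambda> b)
      \<le> (A powr (p - 1) * (1 + p) * p) powr (1 / p) * weighted_lp_norm p (muntz_weight p \<Lambda>) b"
    using Lp(2) p K0 S0
    by (simp add: weighted_lp_norm_def K_def[symmetric] S_def[symmetric] powr_mult)
qed

text \<open>The remainder after \<open>N\<close> terms is the series of a tail of \<open>b\<close>.
  The norm estimate applied to that tail bounds the remainder by a tail of a convergent series, so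
  the partial sums are approximating polynomials.\<close>

lemma muntz_series_in_muntz_space:
  assumes p: "1 < p" and \<Lambda>: "\<And>n. 0 \<le> \<Lambda> n"
    and A: "\<And>N t. 0 < t \<Longrightarrow> t < 1 \<Longrightarrow>
      (\<Sum>n<N. (\<Lambda> n + 1) powr (1 / p) * t powr \<Lambda> n) \<le> A * (1 - t) powr (- 1 / p)"
    and b: "b \<in> weighted_lp p (muntz_weight p \<Lambda>)"
  shows "muntz_series \<Lambda> b \<in> muntz_space p \<Lambda>"
proof -
  define K where "K = (A powr (p - 1) * (1 + p) * p) powr (1 / p)"
  define f where "f n = norm (b n) powr p * muntz_weight p \<Lambda> n" for n
  have sf: "summable f" using b by (simp add: weighted_lp_def f_def[abs_def])
  define r where "r N n = (if n \<in> {..<N} then 0 else b n)" for N n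
  define q where "q N t = (\<Sum>n<N. b n * monomial (\<Lambda> n) t)" for N t
  have tail: "(\<lambda>n. norm (r N n) powr p * muntz_weight p \<Lambda> n) sums (suminf f - sum f {..<N})" for N
  proof -
    have "(\<lambda>n. f n - (if n \<in> {..<N} then f n else 0)) sums (suminf f - sum f {..<N})"
      by (intro sums_diff summable_sums sf sums_If_finite_set) simp
    then show ?thesis
      by (rule sums_cong[THEN iffD1, rotated]) (use p in \<open>auto simp: r_def f_def\<close>)
  qed
  have r: "r N \<in> weighted_lp p (muntz_weight p \<Lambda>)" for N
    using tail[of N] by (auto simp: weighted_lp_def sums_iff)
  \<comment> \<open>Splitting off finitely many terms requires convergence, known inside the
    interval; this suffices for the norm.\<close>
  have eq: "muntz_series \<Lambda> b t - q N t = muntz_series \<Lambda> (r N) t" if t: "0 < t" "t < 1" for t N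
  proof -
    have "(\<lambda>n. b n * monomial (\<Lambda> n) t - (if n \<in> {..<N} then b n * monomial (\<Lambda> n) t else 0))
        sums (muntz_series \<Lambda> b t - q N t)"
      unfolding muntz_series_def q_def
      by (intro sums_diff summable_sums sums_If_finite_set
        muntz_series_pointwise(2)[OF p \<Lambda> t(1) A[OF t] b]) simp
    also have "(\<lambda>n. b n * monomial (\<Lambda> n) t - (if n \<in> {..<N} then b n * monomial (\<Lambda> n) t else 0))
        = (\<lambda>n. r N n * monomial (\<Lambda> n) t)"
      by (auto simp: r_def)
    finally show ?thesis by (simp add: muntz_series_def sums_iff)
  qed
  have [measurable]: "q N \<in> borel_measurable (lebesgue_on {0..1})" for N
    unfolding q_def[abs_def] by measurable
  have bound: "Lp_norm p (\<lambda>t. muntz_series \<Lambda> b t - q N t) \<le> K * (suminf f - sum f {..<N}) powr (1 / p)"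
    for N
  proof -
    have "Lp_norm p (\<lambda>t. muntz_series \<Lambda> b t - q N t) = Lp_norm p (muntz_series \<Lambda> (r N))"
      unfolding Lp_norm_def
      by (intro arg_cong[where f = "\<lambda>x. x powr (1 / p)"] integral_cong_AE)
         (measurable, use AE_unit_interval in eventually_elim, simp add: eq)
    also have "\<dots> \<le> K * weighted_lp_norm p (muntz_weight p \<Lambda>) (r N)"
      unfolding K_def by (rule muntz_series_Lp_bound(2)[OF p \<Lambda> A r])
    finally show ?thesis using tail[of N] by (simp add: weighted_lp_norm_def sums_iff)
  qed
  have "(\<lambda>N. suminf f - sum f {..<N}) \<longlonglongrightarrow> suminf f - suminf f"
    by (intro tendsto_intros summable_LIMSEQ sf)
  then have lim0: "(\<lambda>N. suminf f - sum f {..<N}) \<longlonglongrightarrow> 0" by simp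
  have "(\<lambda>N. (suminf f - sum f {..<N}) powr (1 / p)) \<longlonglongrightarrow> 0"
  proof (rule tendsto_zero_powrI[OF lim0 tendsto_const])
    show "\<forall>\<^sub>F N in sequentially. 0 \<le> suminf f - sum f {..<N}"
      using sum_le_suminf[OF sf] p \<Lambda> by (simp add: f_def muntz_weight_nonneg)
  qed (use p in simp)
  from tendsto_mult_left[OF this, of K]
  have lim: "(\<lambda>N. K * (suminf f - sum f {..<N}) powr (1 / p)) \<longlonglongrightarrow> 0" by simp
  have "\<exists>q \<in> muntz_polynomials \<Lambda>. Lp_norm p (\<lambda>t. muntz_series \<Lambda> b t - q t) < \<epsilon>" if "0 < \<epsilon>" for \<epsilon>
  proof -
    have "\<forall>\<^sub>F N in sequentially. K * (suminf f - sum f {..<N}) powr (1 / p) < \<epsilon>"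
      using order_tendstoD(2)[OF lim that] .
    then obtain N where "K * (suminf f - sum f {..<N}) powr (1 / p) < \<epsilon>"
      by (auto simp: eventually_sequentially)
    then have "Lp_norm p (\<lambda>t. muntz_series \<Lambda> b t - q N t) < \<epsilon>"
      using bound[of N] by linarith
    moreover have "q N \<in> muntz_polynomials \<Lambda>"
      unfolding muntz_polynomials_def q_def[abs_def] by blast
    ultimately show ?thesis by blast
  qed
  then show ?thesis
    using muntz_series_Lp_bound(1)[OF p \<Lambda> A b] by (simp add: muntz_space_def)
qed

section \<open>Necessity: indicators of blocks of indices\<close>

text \<open>With \<open>l\<close> the last exponent of the block, each monomial is at least
  \<open>t powr l\<close>, so the integral of the \<open>p\<close>-th power is at least
  \<open>Suc N powr p / (p * l + 1)\<close>. Each weight is at most \<open>2 / (p * l + 1)\<close>;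
  comparing the two cancels \<open>p * l + 1\<close>.\<close>

lemma block_length_bound:
  assumes p: "1 < p" and "mono \<Lambda>" and \<Lambda>: "\<And>n. 0 \<le> \<Lambda> n"
    and J: "\<And>b. b \<in> weighted_lp p (muntz_weight p \<Lambda>) \<Longrightarrow> muntz_series \<Lambda> b \<in> Lp_space p"
    and C: "\<And>b. b \<in> weighted_lp p (muntz_weight p \<Lambda>) \<Longrightarrow>
      Lp_norm p (muntz_series \<Lambda> b) \<le> C * weighted_lp_norm p (muntz_weight p \<Lambda>) b"
    and "0 \<le> C" and le: "\<Lambda> (n + N) \<le> 2 * \<Lambda> n"
  shows "real (Suc N) \<le> (2 * C powr p) powr (1 / (p - 1))"
proof -
  \<comment> \<open>Both ends are included, so the block has \<open>Suc N\<close> indices.\<close>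
  define B where "B = {n..n + N}"
  have B: "finite B" "card B = Suc N" by (simp_all add: B_def)
  define b :: "nat \<Rightarrow> complex" where "b k = (if k \<in> B then 1 else 0)" for k
  define l where "l = \<Lambda> (n + N)"
  have l: "0 \<le> l" using \<Lambda> by (simp add: l_def)
  have "(\<lambda>k. if k \<in> B then muntz_weight p \<Lambda> k else 0) sums sum (muntz_weight p \<Lambda>) B"
    by (rule sums_If_finite_set) (rule B)
  then have sums: "(\<lambda>k. norm (b k) powr p * muntz_weight p \<Lambda> k) sums sum (muntz_weight p \<Lambda>) B"
    by (rule sums_cong[THEN iffD1, rotated]) (simp add: b_def)
  then have b: "b \<in> weighted_lp p (muntz_weight p \<Lambda>)"
    by (auto simp: weighted_lp_def sums_iff)
  define I where "I = (LINT t|lebesgue_on {0..1}. norm (muntz_series \<Lambda> b t) powr p)"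
  have I0: "0 \<le> I" by (simp add: I_def)
  have int: "integrable (lebesgue_on {0..1}) (\<lambda>t. norm (muntz_series \<Lambda> b t) powr p)"
    using J[OF b] by (simp add: Lp_space_def)
  have "ennreal (Suc N powr p / (p * l + 1)) \<le> ennreal I"
  proof -
    have "- 1 < p * l" using mult_nonneg_nonneg[of p l] p l by linarith
    then have "((\<lambda>t. Suc N powr p * t powr (p * l)) has_integral
        Suc N powr p * (1 powr (p * l + 1) / (p * l + 1))) {0..1}"
      by (intro has_integral_mult_right has_integral_powr_from_0) auto
    then have hI: "((\<lambda>t. Suc N powr p * t powr (p * l)) has_integral Suc N powr p / (p * l + 1)) {0..1}"
      by simp
    have "ennreal (Suc N powr p / (p * l + 1))
        = (\<integral>\<^sup>+t. ennreal (Suc N powr p * t powr (p * l)) \<partial>lebesgue_on {0..1})"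
      by (rule nn_integral_lebesgue_on_has_integral[OF _ _ hI, symmetric]) auto
    also have "\<dots> \<le> (\<integral>\<^sup>+t. ennreal (norm (muntz_series \<Lambda> b t) powr p) \<partial>lebesgue_on {0..1})"
    proof (rule nn_integral_mono_AE, use AE_unit_interval in eventually_elim)
      fix t :: real assume t: "0 < t \<and> t < 1"
      have "(\<lambda>k. if k \<in> B then monomial (\<Lambda> k) t else 0) sums (\<Sum>k\<in>B. monomial (\<Lambda> k) t)"
        by (rule sums_If_finite_set) (rule B)
      then have "(\<lambda>k. b k * monomial (\<Lambda> k) t) sums (\<Sum>k\<in>B. monomial (\<Lambda> k) t)"
        by (rule sums_cong[THEN iffD1, rotated]) (simp add: b_def)
      then have "muntz_series \<Lambda> b t = of_real (\<Sum>k\<in>B. t powr \<Lambda> k)"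
        using t by (simp add: muntz_series_def sums_iff monomial_pos)
      then have "norm (muntz_series \<Lambda> b t) = \<bar>\<Sum>k\<in>B. t powr \<Lambda> k\<bar>"
        by (simp only: norm_of_real)
      then have eq: "norm (muntz_series \<Lambda> b t) = (\<Sum>k\<in>B. t powr \<Lambda> k)"
        by (simp add: sum_nonneg)
      have "Suc N * t powr l = (\<Sum>k\<in>B. t powr l)" by (simp add: B)
      also have "\<dots> \<le> (\<Sum>k\<in>B. t powr \<Lambda> k)"
        using t \<open>mono \<Lambda>\<close> by (intro sum_mono powr_mono') (auto simp: B_def l_def mono_def)
      finally have "(Suc N * t powr l) powr p \<le> norm (muntz_series \<Lambda> b t) powr p"
        unfolding eq using p by (intro powr_mono2) auto
      then show "ennreal (Suc N powr p * t powr (p * l)) \<le> ennreal (norm (muntz_series \<Lambda> b t) powr p)"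
        by (intro ennreal_leI) (simp add: powr_mult powr_powr mult.commute)
    qed
    also have "\<dots> = ennreal I"
      unfolding I_def by (rule nn_integral_eq_integral[OF int]) simp
    finally show ?thesis .
  qed
  then have "Suc N powr p / (p * l + 1) \<le> I" using I0 by simp
  also have "\<dots> = Lp_norm p (muntz_series \<Lambda> b) powr p"
    using p I0 by (simp add: Lp_norm_def I_def[symmetric] powr_powr)
  also have "\<dots> \<le> (C * weighted_lp_norm p (muntz_weight p \<Lambda>) b) powr p"
    using p C[OF b] by (intro powr_mono2) (auto simp: Lp_norm_def)
  also have "\<dots> = C powr p * sum (muntz_weight p \<Lambda>) B"
  proof -
    have "0 \<le> sum (muntz_weight p \<Lambda>) B"
      using p \<Lambda> by (intro sum_nonneg muntz_weight_nonneg) auto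
    then show ?thesis
      using sums p \<open>0 \<le> C\<close> by (simp add: weighted_lp_norm_def sums_iff powr_mult powr_powr)
  qed
  also have "\<dots> \<le> C powr p * (Suc N * (2 / (p * l + 1)))"
  proof -
    \<comment> \<open>By monotonicity \<open>l \<le> 2 * \<Lambda> n \<le> 2 * \<Lambda> k\<close>
      on the whole block.\<close>
    have "muntz_weight p \<Lambda> k \<le> 2 / (p * l + 1)" if "k \<in> B" for k
    proof -
      have "\<Lambda> n \<le> \<Lambda> k" using that \<open>mono \<Lambda>\<close> by (auto simp: B_def mono_def)
      then have "p * l \<le> p * (2 * \<Lambda> k)" using le p by (intro mult_left_mono) (auto simp: l_def)
      then have "p * l + 1 \<le> 2 * (p * \<Lambda> k + 1)" by (simp add: algebra_simps)
      moreover have "0 < p * l + 1" "0 < p * \<Lambda> k + 1" using p l \<Lambda>[of k] by (auto intro!: add_nonneg_pos)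
      ultimately show ?thesis by (simp add: muntz_weight_def divide_simps mult.commute)
    qed
    then show ?thesis using sum_bounded_above[of B "muntz_weight p \<Lambda>" "2 / (p * l + 1)"]
      by (intro mult_left_mono) (auto simp: B)
  qed
  finally have "Suc N powr p / (p * l + 1) \<le> Suc N * (2 * C powr p) / (p * l + 1)"
    by (simp add: field_simps)
  then have "Suc N powr p \<le> Suc N * (2 * C powr p)"
    using p l by (simp add: divide_le_cancel add_nonneg_pos)
  then have "Suc N powr (p - 1) \<le> 2 * C powr p"
    by (simp add: powr_diff field_simps)
  then have "(Suc N powr (p - 1)) powr (1 / (p - 1)) \<le> (2 * C powr p) powr (1 / (p - 1))"
    using p by (intro powr_mono2) auto
  then show ?thesis using p by (simp add: powr_powr)
qed

section \<open>Quasi-lacunarity and boundedness of the operator\<close>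

theorem theorem3p5:
  fixes p :: real and \<Lambda> :: "nat \<Rightarrow> real"
  assumes "1 < p"
    and "mono \<Lambda>"
    and "\<And>n. 0 \<le> \<Lambda> n"
    and "summable (\<lambda>n. 1 / \<Lambda> (Suc n))"
    and "0 < (INF n. \<Lambda> (Suc n) - \<Lambda> n)"
  shows "quasi_lacunary \<Lambda> \<longleftrightarrow>
    bounded_operator_lp_Lp p (muntz_weight p \<Lambda>) (muntz_space p \<Lambda>) (muntz_series \<Lambda>)"
proof
  note p = assms(1) and nonneg = assms(3)
  define \<delta> where "\<delta> = (INF n. \<Lambda> (Suc n) - \<Lambda> n)"
  have "0 < \<delta>" using assms(5) by (simp add: \<delta>_def)
  \<comment> \<open>A real infimum is a lower bound only of a set bounded below; monotonicity
    provides the bound 0.\<close>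
  have "bdd_below (range (\<lambda>n. \<Lambda> (Suc n) - \<Lambda> n))"
    using assms(2) by (intro bdd_belowI[of _ 0]) (auto simp: mono_def)
  then have gap: "\<Lambda> n + \<delta> \<le> \<Lambda> (Suc n)" for n
    using cINF_lower[of "\<lambda>n. \<Lambda> (Suc n) - \<Lambda> n" UNIV n] by (simp add: \<delta>_def)
  {
    assume "quasi_lacunary \<Lambda>"
    then obtain M \<rho> where \<rho>: "1 < \<rho>" "\<And>n. \<rho> * (\<Lambda> n + 1) \<le> \<Lambda> (n + M) + 1"
      using quasi_lacunary_imp_ratio assms(2) nonneg \<open>0 < \<delta>\<close> gap by metis
    define c where "c = 4 * real M * (\<rho> powr (1 / p) / (\<rho> powr (1 / p) - 1))"
    have A: "(\<Sum>n<N. (\<Lambda> n + 1) powr (1 / p) * t powr \<Lambda> n) \<le> exp 1 * c * (1 - t) powr (- 1 / p)"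
      if t: "0 < t" "t < 1" for N t
    proof -
      \<comment> \<open>This follows from \<open>ln t \<le> t - 1\<close>; the factor
        \<open>exp 1\<close> absorbs the change from \<open>\<Lambda> n\<close> to
        \<open>\<Lambda> n + 1\<close> in the exponent, because
        \<open>1 - t \<le> 1\<close>.\<close>
      have "t powr \<Lambda> n \<le> exp 1 * exp (- ((\<Lambda> n + 1) * (1 - t)))" for n
      proof -
        have "ln t \<le> t - 1" using t by (simp add: ln_le_minus_one)
        then have "\<Lambda> n * ln t \<le> \<Lambda> n * (t - 1)" using nonneg by (rule mult_left_mono)
        also have "\<dots> \<le> 1 + - ((\<Lambda> n + 1) * (1 - t))" using t by (simp add: algebra_simps)
        finally show ?thesis using t by (simp add: powr_def flip: exp_add)
      qed
      then have "(\<Sum>n<N. (\<Lambda> n + 1) powr (1 / p) * t powr \<Lambda> n)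
          \<le> (\<Sum>n<N. (\<Lambda> n + 1) powr (1 / p) * (exp 1 * exp (- ((\<Lambda> n + 1) * (1 - t)))))"
        by (intro sum_mono mult_left_mono) auto
      also have "\<dots> = exp 1 * (\<Sum>n<N. (\<Lambda> n + 1) powr (1 / p) * exp (- ((\<Lambda> n + 1) * (1 - t))))"
        by (simp add: sum_distrib_left mult.left_commute)
      also have "\<dots> \<le> exp 1 * (c * (1 - t) powr (- (1 / p)))"
        unfolding c_def using p t \<rho> nonneg
        by (intro mult_left_mono sum_powr_exp_bound) (auto simp: add_nonneg_pos)
      finally show ?thesis by simp
    qed
    show "bounded_operator_lp_Lp p (muntz_weight p \<Lambda>) (muntz_space p \<Lambda>) (muntz_series \<Lambda>)"
      unfolding bounded_operator_lp_Lp_def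
      using muntz_series_in_muntz_space[OF p nonneg A] muntz_series_Lp_bound(2)[OF p nonneg A] by blast
  }
  assume "bounded_operator_lp_Lp p (muntz_weight p \<Lambda>) (muntz_space p \<Lambda>) (muntz_series \<Lambda>)"
  then obtain C where J: "\<And>b. b \<in> weighted_lp p (muntz_weight p \<Lambda>) \<Longrightarrow> muntz_series \<Lambda> b \<in> Lp_space p"
    and C: "\<And>b. b \<in> weighted_lp p (muntz_weight p \<Lambda>) \<Longrightarrow>
      Lp_norm p (muntz_series \<Lambda> b) \<le> C * weighted_lp_norm p (muntz_weight p \<Lambda>) b"
    unfolding bounded_operator_lp_Lp_def muntz_space_def by blast
  \<comment> \<open>The block test needs a nonnegative constant, and the weighted norm is
    nonnegative.\<close>
  have C': "Lp_norm p (muntz_series \<Lambda> b) \<le> \<bar>C\<bar> * weighted_lp_norm p (muntz_weight p \<Lambda>) b"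
    if "b \<in> weighted_lp p (muntz_weight p \<Lambda>)" for b
    by (rule order_trans[OF C[OF that]]) (auto intro!: mult_right_mono simp: weighted_lp_norm_def)
  \<comment> \<open>A block of \<open>Suc N\<close> indices on which \<Lambda> at most doubles would
    contradict this choice. It also forces \<open>N > 0\<close>, since the left side is
    nonnegative.\<close>
  obtain N :: nat where N: "(2 * \<bar>C\<bar> powr p) powr (1 / (p - 1)) < real N"
    using reals_Archimedean2 by blast
  have double: "2 * \<Lambda> n \<le> \<Lambda> (n + N)" for n
    using block_length_bound[OF p assms(2) nonneg J C', of n N] N by (cases "\<Lambda> (n + N) \<le> 2 * \<Lambda> n") auto
  \<comment> \<open>The extraction starts at index 1 because \<open>\<Lambda> 0\<close> may vanish,
    whereas \<open>\<Lambda> 1 \<ge> \<delta> > 0\<close>.\<close>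
  define s where "s k = Suc (k * N)" for k
  have "0 < N" using N by (rule_tac ccontr) (simp add: not_less[symmetric])
  have "0 < \<Lambda> (s k)" for k
    using gap[of 0] nonneg[of 0] \<open>0 < \<delta>\<close> monoD[OF assms(2), of "Suc 0" "s k"] by (simp add: s_def)
  moreover have "2 * \<Lambda> (s k) \<le> \<Lambda> (s (Suc k))" for k
    using double[of "s k"] by (simp add: s_def add.commute)
  ultimately have "lacunary (\<lambda>k. \<Lambda> (s k))"
    unfolding lacunary_def by (intro conjI allI exI[of _ 2]) auto
  moreover have "strict_mono s"
    using \<open>0 < N\<close> by (auto simp: strict_mono_Suc_iff s_def)
  moreover have "bdd_above (range (\<lambda>k. s (Suc k) - s k))"
    by (intro bdd_aboveI[of _ N]) (auto simp: s_def)
  ultimately show "quasi_lacunary \<Lambda>" unfolding quasi_lacunary_def by blast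
qed

end
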